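(* Let $\mathbb{A}$ be a finite category and $X: \mathbb{A} \to \mathbf{Cat}$ a finite weak functor. Let $k^\bullet$ be a weighting on $\mathbb{A}$ and suppose that the category of elements $\mathbb{E}(X)$ and each category $Xa$ ($a \in \mathbb{A}$) have Euler characteristic. Then $$\chi(\mathbb{E}(X)) = \sum_{a \in \mathbb{A}} k^a\, \chi(Xa).$$
   Context: For a finite category $\mathbb{A}$, a weighting on $\mathbb{A}$ is a function $k^\bullet: \mathrm{ob}\,\mathbb{A} \to \mathbb{Q}$ such that $\sum_{b} |\mathbb{A}(a,b)|\, k^b = 1$ for all $a \in \mathbb{A}$. A coweighting $k_\bullet$ on $\mathbb{A}$ is a weighting on $\mathbb{A}^{\mathrm{op}}$. A finite category $\mathbb{A}$ has Euler characteristic if it admits both a weighting and a coweighting; its Euler characteristic is then $\chi(\mathbb{A}) = \sum_a k^a = \sum_a k_a \in \mathbb{Q}$ for any weighting $k^\bullet$ and coweighting $k_\bullet$ (the two sums agree and do not depend on the choices). $\mathbf{Cat}$ is the category (2-category) of small categories and functors. A weak functor $X: \mathbb{A} \to \mathbf{Cat}$ is a pseudofunctor, i.e. it preserves composition and identities only up to coherent isomorphism. Its category of elements $\mathbb{E}(X)$ has as objects the pairs $(a,x)$ with $a \in \mathbb{A}$ and $x \in Xa$; maps $(a,x) \to (a',x')$ are pairs $(f,\xi)$ where $f: a \to a'$ in $\mathbb{A}$ and $\xi: (Xf)(x) \to x'$ in $Xa'$. The weak functor $X$ is finite if $\mathbb{E}(X)$ is finite; since $\mathbb{A}$ is finite,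 this means that each category $Xa$ is finite. *)

theory Defs
  imports Complex_Main
begin

record ('o, 'm) cat =
  Obj :: "'o set"
  Arr :: "'m set"
  Src :: "'m \<Rightarrow> 'o"
  Tgt :: "'m \<Rightarrow> 'o"
  One :: "'o \<Rightarrow> 'm"
  Cmp :: "'m \<Rightarrow> 'm \<Rightarrow> 'm"  (infixr "\<cdot>\<index>" 70)  \<comment> \<open>classical order: \<open>g \<cdot> f\<close> is \<open>g\<close> after \<open>f\<close>\<close>

definition Hom :: "('o, 'm) cat \<Rightarrow> 'o \<Rightarrow> 'o \<Rightarrow> 'm set" where
  "Hom C a b = {f \<in> Arr C. Src C f = a \<and> Tgt C f = b}"

locale category =
  fixes C :: "('o, 'm) cat" (structure)
  assumes Src_in: "f \<in> Arr C \<Longrightarrow> Src C f \<in> Obj C"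
    and Tgt_in: "f \<in> Arr C \<Longrightarrow> Tgt C f \<in> Obj C"
    and One_in: "a \<in> Obj C \<Longrightarrow> One C a \<in> Hom C a a"
    and Cmp_in: "\<lbrakk>f \<in> Hom C a b; g \<in> Hom C b c\<rbrakk> \<Longrightarrow> g \<cdot> f \<in> Hom C a c"
    and One_left: "f \<in> Hom C a b \<Longrightarrow> One C b \<cdot> f = f"
    and One_right: "f \<in> Hom C a b \<Longrightarrow> f \<cdot> One C a = f"
    and Cmp_assoc: "\<lbrakk>f \<in> Hom C a b; g \<in> Hom C b c; h \<in> Hom C c d\<rbrakk>
      \<Longrightarrow> h \<cdot> (g \<cdot> f) = (h \<cdot> g) \<cdot> f"

locale finite_category = category +
  assumes finite_Obj: "finite (Obj C)"
    and finite_Arr: "finite (Arr C)"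

definition opposite :: "('o, 'm) cat \<Rightarrow> ('o, 'm) cat" where
  "opposite C = \<lparr>Obj = Obj C, Arr = Arr C, Src = Tgt C, Tgt = Src C, One = One C,
                 Cmp = (\<lambda>g f. f \<cdot>\<^bsub>C\<^esub> g)\<rparr>"

definition isomorphism :: "('o, 'm) cat \<Rightarrow> 'm \<Rightarrow> bool" where
  "isomorphism C f \<longleftrightarrow> f \<in> Arr C \<and>
     (\<exists>g \<in> Hom C (Tgt C f) (Src C f).
        g \<cdot>\<^bsub>C\<^esub> f = One C (Src C f) \<and> f \<cdot>\<^bsub>C\<^esub> g = One C (Tgt C f))"

record ('x, 'y, 'u, 'v) cat_map =
  on_Obj :: "'x \<Rightarrow> 'u"
  on_Arr :: "'y \<Rightarrow> 'v"

locale cat_functor = category C + target: category D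
  for C :: "('x, 'y) cat" and D :: "('u, 'v) cat" +
  fixes F :: "('x, 'y, 'u, 'v) cat_map"
  assumes on_Obj_in: "x \<in> Obj C \<Longrightarrow> on_Obj F x \<in> Obj D"
    and on_Arr_in: "f \<in> Hom C x y \<Longrightarrow> on_Arr F f \<in> Hom D (on_Obj F x) (on_Obj F y)"
    and on_Arr_One: "x \<in> Obj C \<Longrightarrow> on_Arr F (One C x) = One D (on_Obj F x)"
    and on_Arr_Cmp: "\<lbrakk>f \<in> Hom C x y; g \<in> Hom C y z\<rbrakk>
      \<Longrightarrow> on_Arr F (g \<cdot>\<^bsub>C\<^esub> f) = on_Arr F g \<cdot>\<^bsub>D\<^esub> on_Arr F f"

definition id_map :: "('x, 'y, 'x, 'y) cat_map" where
  "id_map = \<lparr>on_Obj = (\<lambda>x. x), on_Arr = (\<lambda>f. f)\<rparr>"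

definition comp_map ::
  "('u, 'v, 's, 't) cat_map \<Rightarrow> ('x, 'y, 'u, 'v) cat_map \<Rightarrow> ('x, 'y, 's, 't) cat_map" where
  "comp_map G F = \<lparr>on_Obj = on_Obj G \<circ> on_Obj F, on_Arr = on_Arr G \<circ> on_Arr F\<rparr>"

definition natural_iso ::
  "('x, 'y) cat \<Rightarrow> ('u, 'v) cat \<Rightarrow> ('x, 'y, 'u, 'v) cat_map \<Rightarrow> ('x, 'y, 'u, 'v) cat_map
    \<Rightarrow> ('x \<Rightarrow> 'v) \<Rightarrow> bool" where
  "natural_iso C D F G \<alpha> \<longleftrightarrow> cat_functor C D F \<and> cat_functor C D G \<and>
     (\<forall>x \<in> Obj C. \<alpha> x \<in> Hom D (on_Obj F x) (on_Obj G x) \<and> isomorphism D (\<alpha> x)) \<and>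
     (\<forall>x \<in> Obj C. \<forall>y \<in> Obj C. \<forall>f \<in> Hom C x y.
        \<alpha> y \<cdot>\<^bsub>D\<^esub> on_Arr F f = on_Arr G f \<cdot>\<^bsub>D\<^esub> \<alpha> x)"

text \<open>
  The components of the structural isomorphisms are
  \<open>w_comp X g f x : X (g \<cdot> f) x \<rightarrow> X g (X f x)\<close> and \<open>w_unit X a x : X 1\<^sub>a x \<rightarrow> x\<close>.
  That all the categories \<open>X a\<close> live over one pair of types is no restriction, since a
  set-indexed family of small categories can be tagged into a disjoint union.
\<close>

record ('o, 'm, 'x, 'y) weak_functor_data =
  w_Obj :: "'o \<Rightarrow> ('x, 'y) cat"
  w_Arr :: "'m \<Rightarrow> ('x, 'y, 'x, 'y) cat_map"
  w_comp :: "'m \<Rightarrow> 'm \<Rightarrow> 'x \<Rightarrow> 'y"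
  w_unit :: "'o \<Rightarrow> 'x \<Rightarrow> 'y"

locale weak_functor = category A for A :: "('o, 'm) cat" +
  fixes X :: "('o, 'm, 'x, 'y) weak_functor_data"
  assumes w_Obj_category: "a \<in> Obj A \<Longrightarrow> category (w_Obj X a)"
    and w_Arr_functor: "f \<in> Hom A a b \<Longrightarrow> cat_functor (w_Obj X a) (w_Obj X b) (w_Arr X f)"
    and w_comp_iso: "\<lbrakk>f \<in> Hom A a b; g \<in> Hom A b c\<rbrakk>
      \<Longrightarrow> natural_iso (w_Obj X a) (w_Obj X c)
            (w_Arr X (g \<cdot>\<^bsub>A\<^esub> f)) (comp_map (w_Arr X g) (w_Arr X f)) (w_comp X g f)"
    and w_unit_iso: "a \<in> Obj A
      \<Longrightarrow> natural_iso (w_Obj X a) (w_Obj X a) (w_Arr X (One A a)) id_map (w_unit X a)"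
    and w_assoc: "\<lbrakk>f \<in> Hom A a b; g \<in> Hom A b c; h \<in> Hom A c d; x \<in> Obj (w_Obj X a)\<rbrakk>
      \<Longrightarrow> on_Arr (w_Arr X h) (w_comp X g f x) \<cdot>\<^bsub>w_Obj X d\<^esub> w_comp X h (g \<cdot>\<^bsub>A\<^esub> f) x
        = w_comp X h g (on_Obj (w_Arr X f) x) \<cdot>\<^bsub>w_Obj X d\<^esub> w_comp X (h \<cdot>\<^bsub>A\<^esub> g) f x"
    and w_unit_left: "\<lbrakk>f \<in> Hom A a b; x \<in> Obj (w_Obj X a)\<rbrakk>
      \<Longrightarrow> w_unit X b (on_Obj (w_Arr X f) x) \<cdot>\<^bsub>w_Obj X b\<^esub> w_comp X (One A b) f x
        = One (w_Obj X b) (on_Obj (w_Arr X f) x)"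
    and w_unit_right: "\<lbrakk>f \<in> Hom A a b; x \<in> Obj (w_Obj X a)\<rbrakk>
      \<Longrightarrow> on_Arr (w_Arr X f) (w_unit X a x) \<cdot>\<^bsub>w_Obj X b\<^esub> w_comp X f (One A a) x
        = One (w_Obj X b) (on_Obj (w_Arr X f) x)"

text \<open>
  A map \<open>(a, x) \<rightarrow> (a', x')\<close> of the category of elements is a pair \<open>(f, \<xi>)\<close> with
  \<open>f : a \<rightarrow> a'\<close> and \<open>\<xi> : X f x \<rightarrow> x'\<close>.  Such a pair does not determine \<open>x\<close>, so an arrow
  is stored together with its source and target, as \<open>((a, x), (f, \<xi>), (a', x'))\<close>.
  The composite of \<open>(f, \<xi>) : (a, x) \<rightarrow> (b, y)\<close> and \<open>(g, \<eta>) : (b, y) \<rightarrow> (c, z)\<close> has as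
  second component \<open>X (g \<cdot> f) x \<rightarrow> X g (X f x) \<rightarrow> X g y \<rightarrow> z\<close>.
\<close>

definition elements ::
  "('o, 'm) cat \<Rightarrow> ('o, 'm, 'x, 'y) weak_functor_data
    \<Rightarrow> ('o \<times> 'x, ('o \<times> 'x) \<times> ('m \<times> 'y) \<times> ('o \<times> 'x)) cat" where
  "elements A X = \<lparr>
     Obj = {(a, x). a \<in> Obj A \<and> x \<in> Obj (w_Obj X a)},
     Arr = {((a, x), (f, \<xi>), (a', x')).
              a \<in> Obj A \<and> x \<in> Obj (w_Obj X a) \<and> a' \<in> Obj A \<and> x' \<in> Obj (w_Obj X a') \<and>
              f \<in> Hom A a a' \<and> \<xi> \<in> Hom (w_Obj X a') (on_Obj (w_Arr X f) x) x'},
     Src = (\<lambda>(p, _, q). p),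
     Tgt = (\<lambda>(p, _, q). q),
     One = (\<lambda>(a, x). ((a, x), (One A a, w_unit X a x), (a, x))),
     Cmp = (\<lambda>((b, y), (g, \<eta>), (c, z)) ((a, x), (f, \<xi>), _).
       ((a, x),
        (g \<cdot>\<^bsub>A\<^esub> f, \<eta> \<cdot>\<^bsub>w_Obj X c\<^esub> on_Arr (w_Arr X g) \<xi> \<cdot>\<^bsub>w_Obj X c\<^esub> w_comp X g f x),
        (c, z)))\<rparr>"

text \<open>
  Finiteness is the only new content here: lemma \<open>category_elements\<close> below shows that
  \<open>elements A X\<close> is a category for every weak functor.
\<close>

definition finite_weak_functor ::
  "('o, 'm) cat \<Rightarrow> ('o, 'm, 'x, 'y) weak_functor_data \<Rightarrow> bool" where
  "finite_weak_functor A X \<longleftrightarrow> weak_functor A X \<and> finite_category (elements A X)"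

text \<open>
  The following notions are meaningful for finite categories only (the cardinality of an
  infinite set and a sum over an infinite set are both \<open>0\<close>).  Values of a (co)weighting
  outside \<open>Obj C\<close> are irrelevant.
\<close>

definition weighting :: "('o, 'm) cat \<Rightarrow> ('o \<Rightarrow> rat) \<Rightarrow> bool" where
  "weighting C k \<longleftrightarrow> (\<forall>a \<in> Obj C. (\<Sum>b \<in> Obj C. of_nat (card (Hom C a b)) * k b) = 1)"

definition coweighting :: "('o, 'm) cat \<Rightarrow> ('o \<Rightarrow> rat) \<Rightarrow> bool" where
  "coweighting C k \<longleftrightarrow> weighting (opposite C) k"

definition has_euler_characteristic :: "('o, 'm) cat \<Rightarrow> bool" where
  "has_euler_characteristic C \<longleftrightarrow> (\<exists>k. weighting C k) \<and> (\<exists>k. coweighting C k)"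

definition euler_characteristic :: "('o, 'm) cat \<Rightarrow> rat" where
  "euler_characteristic C =
     (THE q. (\<forall>k. weighting C k \<longrightarrow> (\<Sum>a \<in> Obj C. k a) = q) \<and>
             (\<forall>k. coweighting C k \<longrightarrow> (\<Sum>a \<in> Obj C. k a) = q))"

lemma sum_weighting_eq_sum_coweighting:
  assumes "weighting C k" "coweighting C l"
  shows "(\<Sum>a \<in> Obj C. k a) = (\<Sum>a \<in> Obj C. l a)"
proof -
  have op: "Hom (opposite C) b a = Hom C a b" for a b
    by (auto simp: opposite_def Hom_def)
  have "(\<Sum>a \<in> Obj C. l a) = (\<Sum>a \<in> Obj C. l a * (\<Sum>b \<in> Obj C. of_nat (card (Hom C a b)) * k b))"
    using assms(1) by (intro sum.cong) (auto simp: weighting_def)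
  also have "\<dots> = (\<Sum>a \<in> Obj C. \<Sum>b \<in> Obj C. k b * (of_nat (card (Hom C a b)) * l a))"
    by (simp add: sum_distrib_left mult_ac)
  also have "\<dots> = (\<Sum>b \<in> Obj C. k b * (\<Sum>a \<in> Obj C. of_nat (card (Hom C a b)) * l a))"
    by (subst sum.swap) (simp add: sum_distrib_left)
  also have "\<dots> = (\<Sum>b \<in> Obj C. k b)"
    using assms(2) unfolding coweighting_def weighting_def op
    by (intro sum.cong) (auto simp: opposite_def)
  finally show ?thesis by simp
qed

lemma euler_characteristic_eq:
  assumes "weighting C k" "coweighting C l"
  shows "euler_characteristic C = (\<Sum>a \<in> Obj C. k a)"
    and "euler_characteristic C = (\<Sum>a \<in> Obj C. l a)"
proof -
  show 1: "euler_characteristic C = (\<Sum>a \<in> Obj C. k a)"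
    unfolding euler_characteristic_def
  proof (rule the_equality)
    show "(\<forall>k'. weighting C k' \<longrightarrow> sum k' (Obj C) = sum k (Obj C)) \<and>
          (\<forall>k'. coweighting C k' \<longrightarrow> sum k' (Obj C) = sum k (Obj C))"
      using assms sum_weighting_eq_sum_coweighting by metis
  qed (use assms in blast)
  show "euler_characteristic C = (\<Sum>a \<in> Obj C. l a)"
    using 1 sum_weighting_eq_sum_coweighting[OF assms] by simp
qed

lemma category_opposite:
  assumes "category C" shows "category (opposite C)"
proof -
  interpret category C by fact
  show ?thesis
    by unfold_locales
      (use Src_in Tgt_in One_in Cmp_in One_left One_right Cmp_assoc in
        \<open>auto simp: opposite_def Hom_def\<close>)
qed

context weak_functor begin

lemma elements_Hom:
  "p \<in> Hom (elements A X) (a, x) (b, y) \<longleftrightarrow>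
     (\<exists>f \<xi>. p = ((a, x), (f, \<xi>), (b, y)) \<and> x \<in> Obj (w_Obj X a) \<and> y \<in> Obj (w_Obj X b) \<and>
        f \<in> Hom A a b \<and> \<xi> \<in> Hom (w_Obj X b) (on_Obj (w_Arr X f) x) y)"
  using Src_in Tgt_in by (auto simp: elements_def Hom_def)

lemma category_elements: "category (elements A X)"
proof
  fix p
  assume "p \<in> Arr (elements A X)"
  then show "Src (elements A X) p \<in> Obj (elements A X)"
    and "Tgt (elements A X) p \<in> Obj (elements A X)"
    by (auto simp: elements_def)
next
  fix s assume s: "s \<in> Obj (elements A X)"
  obtain a x where sx: "s = (a, x)" by (cases s)
  with s have ax: "a \<in> Obj A" "x \<in> Obj (w_Obj X a)" by (auto simp: elements_def)
  have "w_unit X a x \<in> Hom (w_Obj X a) (on_Obj (w_Arr X (One A a)) x) x"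
    using w_unit_iso[OF ax(1)] ax(2) by (auto simp: natural_iso_def id_map_def)
  then show "One (elements A X) s \<in> Hom (elements A X) s s"
    unfolding sx elements_Hom using ax One_in by (auto simp: elements_def)
next
  fix p q s t u
  assume p: "p \<in> Hom (elements A X) s t" and q: "q \<in> Hom (elements A X) t u"
  obtain a x b y c z where e: "s = (a, x)" "t = (b, y)" "u = (c, z)" by (metis surj_pair)
  from p obtain f \<xi> where f: "p = ((a, x), (f, \<xi>), (b, y))" "x \<in> Obj (w_Obj X a)"
    "y \<in> Obj (w_Obj X b)" "f \<in> Hom A a b" "\<xi> \<in> Hom (w_Obj X b) (on_Obj (w_Arr X f) x) y"
    unfolding e elements_Hom by auto
  from q obtain g \<eta> where g: "q = ((b, y), (g, \<eta>), (c, z))"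
    "z \<in> Obj (w_Obj X c)" "g \<in> Hom A b c" "\<eta> \<in> Hom (w_Obj X c) (on_Obj (w_Arr X g) y) z"
    unfolding e elements_Hom by auto
  interpret G: cat_functor "w_Obj X b" "w_Obj X c" "w_Arr X g" by (rule w_Arr_functor[OF g(3)])
  have "w_comp X g f x \<in> Hom (w_Obj X c) (on_Obj (w_Arr X (g \<cdot>\<^bsub>A\<^esub> f)) x)
      (on_Obj (w_Arr X g) (on_Obj (w_Arr X f) x))"
    using w_comp_iso[OF f(4) g(3)] f(2) by (auto simp: natural_iso_def comp_map_def)
  then have "\<eta> \<cdot>\<^bsub>w_Obj X c\<^esub> on_Arr (w_Arr X g) \<xi> \<cdot>\<^bsub>w_Obj X c\<^esub> w_comp X g f x
      \<in> Hom (w_Obj X c) (on_Obj (w_Arr X (g \<cdot>\<^bsub>A\<^esub> f)) x) z"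
    using G.on_Arr_in[OF f(5)] g(4) G.target.Cmp_in by blast
  then show "q \<cdot>\<^bsub>elements A X\<^esub> p \<in> Hom (elements A X) s u"
    using f g Cmp_in[OF f(4) g(3)] unfolding e elements_Hom by (auto simp: elements_def)
next
  fix p s t
  assume p: "p \<in> Hom (elements A X) s t"
  obtain a x b y where e: "s = (a, x)" "t = (b, y)" by (metis surj_pair)
  from p obtain f \<xi> where f: "p = ((a, x), (f, \<xi>), (b, y))" "x \<in> Obj (w_Obj X a)"
    "y \<in> Obj (w_Obj X b)" "f \<in> Hom A a b" "\<xi> \<in> Hom (w_Obj X b) (on_Obj (w_Arr X f) x) y"
    unfolding e elements_Hom by auto
  have ab: "a \<in> Obj A" "b \<in> Obj A" using f(4) Src_in Tgt_in by (auto simp: Hom_def)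
  interpret F: cat_functor "w_Obj X a" "w_Obj X b" "w_Arr X f" by (rule w_Arr_functor[OF f(4)])
  let ?B = "w_Obj X b"
  note fx = F.on_Obj_in[OF f(2)]
  interpret I: cat_functor ?B ?B "w_Arr X (One A b)" by (rule w_Arr_functor[OF One_in[OF ab(2)]])
  have c1: "w_comp X (One A b) f x \<in> Hom ?B (on_Obj (w_Arr X f) x)
      (on_Obj (w_Arr X (One A b)) (on_Obj (w_Arr X f) x))"
    using w_comp_iso[OF f(4) One_in[OF ab(2)]] f(2) One_left[OF f(4)]
    by (auto simp: natural_iso_def comp_map_def)
  have c2: "w_comp X f (One A a) x \<in> Hom ?B (on_Obj (w_Arr X f) x)
      (on_Obj (w_Arr X f) (on_Obj (w_Arr X (One A a)) x))"
    using w_comp_iso[OF One_in[OF ab(1)] f(4)] f(2) One_right[OF f(4)]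
    by (auto simp: natural_iso_def comp_map_def)
  have u1: "w_unit X b z \<in> Hom ?B (on_Obj (w_Arr X (One A b)) z) z" if "z \<in> Obj ?B" for z
    using w_unit_iso[OF ab(2)] that by (auto simp: natural_iso_def id_map_def)
  have u2: "w_unit X a x \<in> Hom (w_Obj X a) (on_Obj (w_Arr X (One A a)) x) x"
    using w_unit_iso[OF ab(1)] f(2) by (auto simp: natural_iso_def id_map_def)
  have n: "w_unit X b y \<cdot>\<^bsub>?B\<^esub> on_Arr (w_Arr X (One A b)) \<xi>
      = \<xi> \<cdot>\<^bsub>?B\<^esub> w_unit X b (on_Obj (w_Arr X f) x)"
    using w_unit_iso[OF ab(2)] f(3,5) fx by (auto simp: natural_iso_def id_map_def)
  have "w_unit X b y \<cdot>\<^bsub>?B\<^esub> on_Arr (w_Arr X (One A b)) \<xi> \<cdot>\<^bsub>?B\<^esub> w_comp X (One A b) f x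
      = (\<xi> \<cdot>\<^bsub>?B\<^esub> w_unit X b (on_Obj (w_Arr X f) x)) \<cdot>\<^bsub>?B\<^esub> w_comp X (One A b) f x"
    using F.target.Cmp_assoc[OF c1 I.on_Arr_in[OF f(5)] u1[OF f(3)]] n by simp
  also have "\<dots> = \<xi>"
    using F.target.Cmp_assoc[OF c1 u1[OF fx] f(5)] w_unit_left[OF f(4,2)]
      F.target.One_right[OF f(5)] by simp
  finally show "One (elements A X) t \<cdot>\<^bsub>elements A X\<^esub> p = p"
    using f One_left[OF f(4)] unfolding e by (simp add: elements_def)
  have "\<xi> \<cdot>\<^bsub>?B\<^esub> on_Arr (w_Arr X f) (w_unit X a x) \<cdot>\<^bsub>?B\<^esub> w_comp X f (One A a) x = \<xi>"
    using w_unit_right[OF f(4,2)] F.target.One_right[OF f(5)] by simp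
  then show "p \<cdot>\<^bsub>elements A X\<^esub> One (elements A X) s = p"
    using f One_right[OF f(4)] unfolding e by (simp add: elements_def)
next
  fix p q r s t u v
  assume p: "p \<in> Hom (elements A X) s t" and q: "q \<in> Hom (elements A X) t u"
    and r: "r \<in> Hom (elements A X) u v"
  obtain a x b y c z d w where e: "s = (a, x)" "t = (b, y)" "u = (c, z)" "v = (d, w)"
    by (metis surj_pair)
  from p obtain f \<xi> where f: "p = ((a, x), (f, \<xi>), (b, y))" "x \<in> Obj (w_Obj X a)"
    "y \<in> Obj (w_Obj X b)" "f \<in> Hom A a b" "\<xi> \<in> Hom (w_Obj X b) (on_Obj (w_Arr X f) x) y"
    unfolding e elements_Hom by auto
  from q obtain g \<eta> where g: "q = ((b, y), (g, \<eta>), (c, z))"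
    "z \<in> Obj (w_Obj X c)" "g \<in> Hom A b c" "\<eta> \<in> Hom (w_Obj X c) (on_Obj (w_Arr X g) y) z"
    unfolding e elements_Hom by auto
  from r obtain h \<zeta> where h: "r = ((c, z), (h, \<zeta>), (d, w))"
    "w \<in> Obj (w_Obj X d)" "h \<in> Hom A c d" "\<zeta> \<in> Hom (w_Obj X d) (on_Obj (w_Arr X h) z) w"
    unfolding e elements_Hom by auto
  interpret F: cat_functor "w_Obj X a" "w_Obj X b" "w_Arr X f" by (rule w_Arr_functor[OF f(4)])
  interpret G: cat_functor "w_Obj X b" "w_Obj X c" "w_Arr X g" by (rule w_Arr_functor[OF g(3)])
  interpret H: cat_functor "w_Obj X c" "w_Obj X d" "w_Arr X h" by (rule w_Arr_functor[OF h(3)])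
  note gf = Cmp_in[OF f(4) g(3)] and hg = Cmp_in[OF g(3) h(3)]
  interpret HG: cat_functor "w_Obj X b" "w_Obj X d" "w_Arr X (h \<cdot>\<^bsub>A\<^esub> g)"
    by (rule w_Arr_functor[OF hg])
  let ?c = "\<lambda>k l. k \<cdot>\<^bsub>w_Obj X d\<^esub> l"
  let ?f = "on_Obj (w_Arr X f)" and ?g = "on_Obj (w_Arr X g)" and ?h = "on_Obj (w_Arr X h)"
    and ?Ag = "on_Arr (w_Arr X g)" and ?Ah = "on_Arr (w_Arr X h)"
  note fx = F.on_Obj_in[OF f(2)]
  note co = H.target.Cmp_assoc and ci = H.target.Cmp_in
  have t1: "w_comp X g f x \<in> Hom (w_Obj X c) (on_Obj (w_Arr X (g \<cdot>\<^bsub>A\<^esub> f)) x) (?g (?f x))"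
    using w_comp_iso[OF f(4) g(3)] f(2) by (auto simp: natural_iso_def comp_map_def)
  have t2: "w_comp X h (g \<cdot>\<^bsub>A\<^esub> f) x \<in> Hom (w_Obj X d) (on_Obj (w_Arr X (h \<cdot>\<^bsub>A\<^esub> g \<cdot>\<^bsub>A\<^esub> f)) x)
      (?h (on_Obj (w_Arr X (g \<cdot>\<^bsub>A\<^esub> f)) x))"
    using w_comp_iso[OF gf h(3)] f(2) by (auto simp: natural_iso_def comp_map_def)
  have t3: "w_comp X (h \<cdot>\<^bsub>A\<^esub> g) f x \<in> Hom (w_Obj X d) (on_Obj (w_Arr X (h \<cdot>\<^bsub>A\<^esub> g \<cdot>\<^bsub>A\<^esub> f)) x)
      (on_Obj (w_Arr X (h \<cdot>\<^bsub>A\<^esub> g)) (?f x))"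
    using w_comp_iso[OF f(4) hg] f(2) Cmp_assoc[OF f(4) g(3) h(3)]
    by (auto simp: natural_iso_def comp_map_def)
  have t4: "w_comp X h g x' \<in> Hom (w_Obj X d) (on_Obj (w_Arr X (h \<cdot>\<^bsub>A\<^esub> g)) x') (?h (?g x'))"
    if "x' \<in> Obj (w_Obj X b)" for x'
    using w_comp_iso[OF g(3) h(3)] that by (auto simp: natural_iso_def comp_map_def)
  have n: "?c (w_comp X h g y) (on_Arr (w_Arr X (h \<cdot>\<^bsub>A\<^esub> g)) \<xi>)
      = ?c (?Ah (?Ag \<xi>)) (w_comp X h g (?f x))"
    using w_comp_iso[OF g(3) h(3)] f(3,5) fx by (auto simp: natural_iso_def comp_map_def)
  note gx = G.on_Arr_in[OF f(5)]
  note T = H.on_Arr_in[OF gx] H.on_Arr_in[OF g(4)] H.on_Arr_in[OF t1]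
  have split: "?Ah (\<eta> \<cdot>\<^bsub>w_Obj X c\<^esub> ?Ag \<xi> \<cdot>\<^bsub>w_Obj X c\<^esub> w_comp X g f x)
      = ?c (?Ah \<eta>) (?c (?Ah (?Ag \<xi>)) (?Ah (w_comp X g f x)))"
    using H.on_Arr_Cmp[OF t1 gx] H.on_Arr_Cmp[OF G.target.Cmp_in[OF t1 gx] g(4)] by simp
  have "?c \<zeta> (?c (?Ah (\<eta> \<cdot>\<^bsub>w_Obj X c\<^esub> ?Ag \<xi> \<cdot>\<^bsub>w_Obj X c\<^esub> w_comp X g f x)) (w_comp X h (g \<cdot>\<^bsub>A\<^esub> f) x))
      = ?c \<zeta> (?c (?Ah \<eta>) (?c (?Ah (?Ag \<xi>)) (?c (?Ah (w_comp X g f x)) (w_comp X h (g \<cdot>\<^bsub>A\<^esub> f) x))))"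
    unfolding split using co[OF t2 T(3) T(1)] co[OF t2 ci[OF T(3) T(1)] T(2)] by simp
  also have "\<dots> = ?c \<zeta> (?c (?Ah \<eta>) (?c (?Ah (?Ag \<xi>))
      (?c (w_comp X h g (?f x)) (w_comp X (h \<cdot>\<^bsub>A\<^esub> g) f x))))"
    using w_assoc[OF f(4) g(3) h(3) f(2)] by simp
  also have "\<dots> = ?c \<zeta> (?c (?Ah \<eta>) (?c (w_comp X h g y)
      (?c (on_Arr (w_Arr X (h \<cdot>\<^bsub>A\<^esub> g)) \<xi>) (w_comp X (h \<cdot>\<^bsub>A\<^esub> g) f x))))"
    using co[OF t3 t4[OF fx] T(1)] co[OF t3 HG.on_Arr_in[OF f(5)] t4[OF f(3)]] n by simp
  also have "\<dots> = ?c (?c \<zeta> (?c (?Ah \<eta>) (w_comp X h g y)))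
      (?c (on_Arr (w_Arr X (h \<cdot>\<^bsub>A\<^esub> g)) \<xi>) (w_comp X (h \<cdot>\<^bsub>A\<^esub> g) f x))"
    using co[OF ci[OF t3 HG.on_Arr_in[OF f(5)]] t4[OF f(3)] T(2)]
      co[OF ci[OF t3 HG.on_Arr_in[OF f(5)]] ci[OF t4[OF f(3)] T(2)] h(4)] by simp
  finally show "r \<cdot>\<^bsub>elements A X\<^esub> (q \<cdot>\<^bsub>elements A X\<^esub> p)
      = (r \<cdot>\<^bsub>elements A X\<^esub> q) \<cdot>\<^bsub>elements A X\<^esub> p"
    using f g h Cmp_assoc[OF f(4) g(3) h(3)] by (simp add: elements_def)
qed

end

end

theory Submission
  imports Defs
begin

text \<open>
  A weighting on the category of elements can be built fibrewise
  (lemma \<open>weighting_elements\<close>).  Given a weighting \<open>k\<close> on \<open>A\<close>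
  and a weighting \<open>w a\<close> on each \<open>X a\<close>, the function \<open>(a, x) \<mapsto> k a * w a x\<close> is a weighting:
  a map \<open>(a, x) \<rightarrow> (b, y)\<close> is a map \<open>f : a \<rightarrow> b\<close> together with a map \<open>X f x \<rightarrow> y\<close> in \<open>X b\<close>, so
  for a fixed \<open>f\<close> the sum over \<open>y\<close> is the weighting equation of \<open>X b\<close> at the object \<open>X f x\<close>,
  and equals \<open>1\<close> whatever \<open>f\<close> is.  What is left is the weighting equation of \<open>A\<close> at \<open>a\<close>.  Since the
  Euler characteristic is the total of any weighting, summing this function over \<open>(a, x)\<close> fibre by
  fibre gives the formula.
\<close>

lemma euler_characteristic_eq_sum_weighting:
  assumes "has_euler_characteristic C" "weighting C k"
  shows "euler_characteristic C = (\<Sum>a \<in> Obj C. k a)"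
  using assms euler_characteristic_eq(1) by (auto simp: has_euler_characteristic_def)

lemma Obj_elements: "Obj (elements A X) = (SIGMA a:Obj A. Obj (w_Obj X a))"
  by (auto simp: elements_def)

context weak_functor begin

lemma Hom_elements_eq_image:
  assumes "x \<in> Obj (w_Obj X a)" "y \<in> Obj (w_Obj X b)"
  shows "Hom (elements A X) (a, x) (b, y) =
    (\<lambda>q. ((a, x), q, (b, y))) `
      (SIGMA f:Hom A a b. Hom (w_Obj X b) (on_Obj (w_Arr X f) x) y)"
  using assms by (auto simp: elements_Hom)

lemma card_Hom_elements:
  assumes "finite_category A" "finite_category (elements A X)"
    and "x \<in> Obj (w_Obj X a)" "y \<in> Obj (w_Obj X b)"
  shows "card (Hom (elements A X) (a, x) (b, y)) =
    (\<Sum>f \<in> Hom A a b. card (Hom (w_Obj X b) (on_Obj (w_Arr X f) x) y))"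
proof -
  let ?H = "\<lambda>f. Hom (w_Obj X b) (on_Obj (w_Arr X f) x) y"
  have inj: "inj_on (\<lambda>q. ((a, x), q, (b, y))) S" for S :: "('m \<times> 'y) set"
    by (auto simp: inj_on_def)
  have base: "finite (Hom A a b)"
    using finite_category.finite_Arr[OF assms(1)] by (simp add: Hom_def)
  have pairs: "finite (SIGMA f:Hom A a b. ?H f)"
  proof -
    have "finite (Hom (elements A X) (a, x) (b, y))"
      using finite_category.finite_Arr[OF assms(2)] by (simp add: Hom_def)
    then show ?thesis
      unfolding Hom_elements_eq_image[OF assms(3,4)] by (simp only: finite_image_iff[OF inj])
  qed
  have fibres: "\<forall>f \<in> Hom A a b. finite (?H f)"
  proof
    fix f assume f: "f \<in> Hom A a b"
    show "finite (?H f)"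
    proof (rule finite_subset[OF _ finite_imageI[OF pairs]])
      show "?H f \<subseteq> snd ` (SIGMA f:Hom A a b. ?H f)"
      proof
        fix g assume "g \<in> ?H f"
        with f have "(f, g) \<in> (SIGMA f:Hom A a b. ?H f)" by blast
        then show "g \<in> snd ` (SIGMA f:Hom A a b. ?H f)" by (rule image_eqI[rotated]) simp
      qed
    qed
  qed
  show ?thesis
    unfolding Hom_elements_eq_image[OF assms(3,4)] card_image[OF inj]
    by (rule card_SigmaI[OF base fibres])
qed

lemma finite_fibre_Obj:
  assumes "finite_category (elements A X)" "a \<in> Obj A"
  shows "finite (Obj (w_Obj X a))"
proof (rule finite_subset)
  show "Obj (w_Obj X a) \<subseteq> snd ` Obj (elements A X)"
    using assms(2) by (force simp: Obj_elements)
  show "finite (snd ` Obj (elements A X))"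
    using finite_category.finite_Obj[OF assms(1)] by simp
qed

lemma sum_Obj_elements:
  assumes "finite_category A" "finite_category (elements A X)"
  shows "(\<Sum>p \<in> Obj (elements A X). h p) = (\<Sum>a \<in> Obj A. \<Sum>x \<in> Obj (w_Obj X a). h (a, x))"
  using finite_category.finite_Obj[OF assms(1)] finite_fibre_Obj[OF assms(2)]
  by (simp add: Obj_elements sum.Sigma)

text \<open>
  Splitting the maps \<open>(a, x) \<rightarrow> (b, y)\<close> according to their component \<open>f : a \<rightarrow> b\<close> turns the inner
  sum over \<open>y\<close> into the weighting equation of \<open>X b\<close> at \<open>X f x\<close>, once for each \<open>f\<close>.
\<close>

lemma weighting_elements:
  assumes fin: "finite_category A" "finite_category (elements A X)"
    and k: "weighting A k"
    and w: "\<And>a. a \<in> Obj A \<Longrightarrow> weighting (w_Obj X a) (w a)"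
  shows "weighting (elements A X) (\<lambda>(a, x). k a * w a x)"
  unfolding weighting_def
proof
  fix p assume "p \<in> Obj (elements A X)"
  then obtain a x where p: "p = (a, x)" and a: "a \<in> Obj A" and x: "x \<in> Obj (w_Obj X a)"
    by (auto simp: Obj_elements)
  have fibre: "(\<Sum>y \<in> Obj (w_Obj X b).
        of_nat (card (Hom (elements A X) (a, x) (b, y))) * (k b * w b y))
      = of_nat (card (Hom A a b)) * k b" if b: "b \<in> Obj A" for b
  proof -
    let ?n = "\<lambda>f y. of_nat (card (Hom (w_Obj X b) (on_Obj (w_Arr X f) x) y)) :: rat"
    have "(\<Sum>y \<in> Obj (w_Obj X b).
          of_nat (card (Hom (elements A X) (a, x) (b, y))) * (k b * w b y))
        = (\<Sum>y \<in> Obj (w_Obj X b). \<Sum>f \<in> Hom A a b. ?n f y * (k b * w b y))"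
      by (intro sum.cong refl) (simp add: card_Hom_elements[OF fin x] sum_distrib_right)
    also have "\<dots> = (\<Sum>f \<in> Hom A a b. k b * (\<Sum>y \<in> Obj (w_Obj X b). ?n f y * w b y))"
      by (subst sum.swap) (simp add: sum_distrib_left mult.left_commute)
    also have "\<dots> = (\<Sum>f \<in> Hom A a b. k b)"
    proof (intro sum.cong refl)
      fix f assume "f \<in> Hom A a b"
      then have "on_Obj (w_Arr X f) x \<in> Obj (w_Obj X b)"
        by (rule cat_functor.on_Obj_in[OF w_Arr_functor x])
      then show "k b * (\<Sum>y \<in> Obj (w_Obj X b). ?n f y * w b y) = k b"
        using w[OF b] by (simp add: weighting_def)
    qed
    finally show ?thesis by simp
  qed
  have "(\<Sum>q \<in> Obj (elements A X).
        of_nat (card (Hom (elements A X) p q)) * (case q of (b, y) \<Rightarrow> k b * w b y))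
      = (\<Sum>b \<in> Obj A. of_nat (card (Hom A a b)) * k b)"
    by (simp add: sum_Obj_elements[OF fin] p fibre)
  then show "(\<Sum>q \<in> Obj (elements A X).
        of_nat (card (Hom (elements A X) p q)) * (case q of (b, y) \<Rightarrow> k b * w b y)) = 1"
    using k a by (simp add: weighting_def)
qed

end

theorem proposition2p8:
  fixes A :: "('o, 'm) cat"
    and X :: "('o, 'm, 'x, 'y) weak_functor_data"
    and k :: "'o \<Rightarrow> rat"
  assumes "finite_category A"
    and "finite_weak_functor A X"
    and "weighting A k"
    and "has_euler_characteristic (elements A X)"
    and "\<And>a. a \<in> Obj A \<Longrightarrow> has_euler_characteristic (w_Obj X a)"
  shows "euler_characteristic (elements A X)
       = (\<Sum>a \<in> Obj A. k a * euler_characteristic (w_Obj X a))"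
proof -
  have fin: "finite_category (elements A X)"
    using assms(2) by (simp add: finite_weak_functor_def)
  interpret weak_functor A X
    using assms(2) by (simp add: finite_weak_functor_def)
  have "\<forall>a. \<exists>w. a \<in> Obj A \<longrightarrow> weighting (w_Obj X a) w"
    using assms(5) by (auto simp: has_euler_characteristic_def)
  then obtain w where w: "\<And>a. a \<in> Obj A \<Longrightarrow> weighting (w_Obj X a) (w a)"
    by metis
  have "euler_characteristic (elements A X) = (\<Sum>(a, x) \<in> Obj (elements A X). k a * w a x)"
    by (rule euler_characteristic_eq_sum_weighting
        [OF assms(4) weighting_elements[OF assms(1) fin assms(3) w]])
  also have "\<dots> = (\<Sum>a \<in> Obj A. k a * (\<Sum>x \<in> Obj (w_Obj X a). w a x))"
    by (simp add: sum_Obj_elements[OF assms(1) fin] sum_distrib_left)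
  also have "\<dots> = (\<Sum>a \<in> Obj A. k a * euler_characteristic (w_Obj X a))"
    by (simp add: euler_characteristic_eq_sum_weighting[OF assms(5) w])
  finally show ?thesis .
qed

end
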